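(* Let $n$ be a positive integer. Each of the following classes has the automorphic Borel amalgamation property (ABAP): (i) the class of all countable graphs $(G,\sim)$; (ii) the class of all countable $K_n$-free graphs; (iii) the class of all countable ordered graphs $(G,<,\sim)$; (iv) the class of all countable ordered $K_n$-free graphs.
   Context: A graph is a set with a symmetric irreflexive relation $\sim$; it is $K_n$-free if it contains no $n$ pairwise adjacent vertices. An ordered graph is a structure $(G,<,\sim)$ with $<$ a strict linear order and $(G,\sim)$ a graph; it is $K_n$-free if $(G,\sim)$ is. ABAP. Let $\mathcal K_\omega$ be a class of countable relational structures in a fixed countable relational language, closed under isomorphism; it is regarded as a standard Borel space in the usual way (coding structures with universe a subset of $\mathbb N$). For $A\in\mathcal K_\omega$, a quantifier-free type $\tau(x)$ in one free variable with finitely many parameters from $A$ is an admissible finite type over $A$ if there is $B\in\mathcal K_\omega$ with $A$ a substructure of $B$ and $B$ containing an element realizing $\tau$. The class $\mathcal K_\omega$ has the ABAP if there is a Borel map $E$ on $\mathcal K_\omega$ such that: (a) for every $A\in\mathcal K_\omega$, $E(A)\in\mathcal K_\omega$ is an extension of $A$ containing witnesses for all admissible finite types over $A$; (b) there is a Borel assignment $(A,\phi)\mapsto\tilde\phi$, from pairs with $A\in\mathcal K_\omega$ and $\phi\in\mathrm{Aut}(A)$, to $\tilde\phi\in\mathrm{Aut}(E(A))$ such that $\phi\subseteq\tilde\phi$ and $\tilde\phi$ has no fixed points in $E(A)\setminus A$; (c) there is an assignment $(A_0,A_1,\alpha)\mapsto\hat\alpha$, from triples with $A_i\in\mathcal K_\omega$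 and $\alpha\colon A_0\cong A_1$ an isomorphism, to isomorphisms $\hat\alpha\colon E(A_0)\cong E(A_1)$ extending $\alpha$, such that whenever $\phi_i\in\mathrm{Aut}(A_i)$ and $\alpha\phi_0=\phi_1\alpha$, we have $\hat\alpha\tilde\phi_0=\tilde\phi_1\hat\alpha$. *)

theory Defs
  imports "HOL-Analysis.Analysis"
begin

section \<open>Coded countable structures\<close>

text \<open>
  A relational language consists of a countable type of relation symbols and an arity function.
  A countable structure is coded by the characteristic functions of its universe (a possibly empty
  subset of the natural numbers) and of its relations (sets of lists of natural numbers). With
  \<^typ>\<open>bool\<close> and \<^typ>\<open>nat\<close> discrete and function types carrying the product topology, \<^term>\<open>borel\<close>
  is the usual Borel structure on codes of structures and on codes of maps between them.
\<close>

type_synonym 'r rstruct = "(nat \<Rightarrow> bool) \<times> ('r \<Rightarrow> nat list \<Rightarrow> bool)"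

definition carr :: "'r rstruct \<Rightarrow> nat set" where
  "carr A = {x. fst A x}"

definition rel :: "'r rstruct \<Rightarrow> 'r \<Rightarrow> nat list \<Rightarrow> bool" where
  "rel A = snd A"

definition is_struct :: "('r \<Rightarrow> nat) \<Rightarrow> 'r rstruct \<Rightarrow> bool" where
  "is_struct ar A \<longleftrightarrow> (\<forall>r xs. rel A r xs \<longrightarrow> length xs = ar r \<and> set xs \<subseteq> carr A)"

text \<open>
  Maps are extensional, so that each map defined on a universe has exactly one code.
\<close>

definition Emb :: "'r rstruct \<Rightarrow> 'r rstruct \<Rightarrow> (nat \<Rightarrow> nat) set" where
  "Emb A B = {f \<in> carr A \<rightarrow>\<^sub>E carr B. inj_on f (carr A) \<and>
      (\<forall>r. \<forall>xs \<in> lists (carr A). rel B r (map f xs) \<longleftrightarrow> rel A r xs)}"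

definition Iso :: "'r rstruct \<Rightarrow> 'r rstruct \<Rightarrow> (nat \<Rightarrow> nat) set" where
  "Iso A B = {f \<in> Emb A B. f ` carr A = carr B}"

definition Aut :: "'r rstruct \<Rightarrow> (nat \<Rightarrow> nat) set" where
  "Aut A = Iso A A"

definition structure_class :: "('r::countable \<Rightarrow> nat) \<Rightarrow> 'r rstruct set \<Rightarrow> bool" where
  "structure_class ar K \<longleftrightarrow>
     (\<forall>A \<in> K. is_struct ar A) \<and>
     (\<forall>A \<in> K. \<forall>B. is_struct ar B \<and> Iso A B \<noteq> {} \<longrightarrow> B \<in> K) \<and>
     K \<in> sets borel"


section \<open>Quantifier-free types in one variable\<close>

datatype 'a tm = Var | Par 'a

datatype ('r, pars: 'a) qf =
    Eq "'a tm" "'a tm"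
  | Rel 'r "'a tm list"
  | Neg "('r, 'a) qf"
  | Conj "('r, 'a) qf" "('r, 'a) qf"

primrec wf_qf :: "('r \<Rightarrow> nat) \<Rightarrow> ('r, 'a) qf \<Rightarrow> bool" where
  "wf_qf ar (Eq s t) \<longleftrightarrow> True"
| "wf_qf ar (Rel r ts) \<longleftrightarrow> length ts = ar r"
| "wf_qf ar (Neg p) \<longleftrightarrow> wf_qf ar p"
| "wf_qf ar (Conj p q) \<longleftrightarrow> wf_qf ar p \<and> wf_qf ar q"

primrec tm_val :: "('a \<Rightarrow> nat) \<Rightarrow> nat \<Rightarrow> 'a tm \<Rightarrow> nat" where
  "tm_val f b Var = b"
| "tm_val f b (Par a) = f a"

text \<open>
  In \<^term>\<open>sat B f b p\<close> the parameters are interpreted in \<^term>\<open>B\<close> through \<^term>\<open>f\<close> (below always an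
  embedding of the structure containing the parameters) and the variable by \<^term>\<open>b\<close>.
\<close>

primrec sat :: "'r rstruct \<Rightarrow> ('a \<Rightarrow> nat) \<Rightarrow> nat \<Rightarrow> ('r, 'a) qf \<Rightarrow> bool" where
  "sat B f b (Eq s t) \<longleftrightarrow> tm_val f b s = tm_val f b t"
| "sat B f b (Rel r ts) \<longleftrightarrow> rel B r (map (tm_val f b) ts)"
| "sat B f b (Neg p) \<longleftrightarrow> \<not> sat B f b p"
| "sat B f b (Conj p q) \<longleftrightarrow> sat B f b p \<and> sat B f b q"

definition realizes :: "'r rstruct \<Rightarrow> ('a \<Rightarrow> nat) \<Rightarrow> nat \<Rightarrow> ('r, 'a) qf set \<Rightarrow> bool" where
  "realizes B f b \<tau> \<longleftrightarrow> b \<in> carr B \<and> (\<forall>p \<in> \<tau>. sat B f b p)"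

definition finite_type :: "('r \<Rightarrow> nat) \<Rightarrow> 'r rstruct \<Rightarrow> ('r, nat) qf set \<Rightarrow> bool" where
  "finite_type ar A \<tau> \<longleftrightarrow>
     (\<forall>p \<in> \<tau>. wf_qf ar p) \<and> finite (\<Union>p \<in> \<tau>. pars p) \<and> (\<Union>p \<in> \<tau>. pars p) \<subseteq> carr A"

text \<open>
  An extension of \<^term>\<open>A\<close> is coded as a structure together with an embedding of \<^term>\<open>A\<close>: if the
  universe of \<^term>\<open>A\<close> is the set of all natural numbers, then no code properly contains \<^term>\<open>A\<close>.
\<close>

definition admissible_type ::
  "('r::countable \<Rightarrow> nat) \<Rightarrow> 'r rstruct set \<Rightarrow> 'r rstruct \<Rightarrow> ('r, nat) qf set \<Rightarrow> bool" where
  "admissible_type ar K A \<tau> \<longleftrightarrow>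
     finite_type ar A \<tau> \<and> (\<exists>B \<in> K. \<exists>f \<in> Emb A B. \<exists>b. realizes B f b \<tau>)"


section \<open>The automorphic Borel amalgamation property\<close>

text \<open>
  \<^term>\<open>\<eta> A\<close> is the inclusion of \<^term>\<open>A\<close> in \<^term>\<open>E A\<close>; since it is part of the code of the
  extension, it has to depend on \<^term>\<open>A\<close> in a Borel way too. \<^term>\<open>T A \<phi>\<close> is the extension of an
  automorphism and \<^term>\<open>H A\<^sub>0 A\<^sub>1 \<alpha>\<close> that of an isomorphism; no measurability is asked of \<^term>\<open>H\<close>.
\<close>

definition ABAP :: "('r::countable \<Rightarrow> nat) \<Rightarrow> 'r rstruct set \<Rightarrow> bool" where
  "ABAP ar K \<longleftrightarrow> structure_class ar K \<and>
    (\<exists>(E :: 'r rstruct \<Rightarrow> 'r rstruct) (\<eta> :: 'r rstruct \<Rightarrow> nat \<Rightarrow> nat)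
      (T :: 'r rstruct \<Rightarrow> (nat \<Rightarrow> nat) \<Rightarrow> nat \<Rightarrow> nat)
      (H :: 'r rstruct \<Rightarrow> 'r rstruct \<Rightarrow> (nat \<Rightarrow> nat) \<Rightarrow> nat \<Rightarrow> nat).
      E \<in> restrict_space borel K \<rightarrow>\<^sub>M borel \<and>
      \<eta> \<in> restrict_space borel K \<rightarrow>\<^sub>M borel \<and>
      (\<forall>A \<in> K. E A \<in> K \<and> \<eta> A \<in> Emb A (E A) \<and>
        (\<forall>\<tau>. admissible_type ar K A \<tau> \<longrightarrow> (\<exists>c. realizes (E A) (\<eta> A) c \<tau>))) \<and>
      (\<lambda>(A, \<phi>). T A \<phi>) \<in> restrict_space borel {(A, \<phi>). A \<in> K \<and> \<phi> \<in> Aut A} \<rightarrow>\<^sub>M borel \<and>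
      (\<forall>A \<in> K. \<forall>\<phi> \<in> Aut A. T A \<phi> \<in> Aut (E A) \<and>
        (\<forall>x \<in> carr A. T A \<phi> (\<eta> A x) = \<eta> A (\<phi> x)) \<and>
        (\<forall>y \<in> carr (E A) - \<eta> A ` carr A. T A \<phi> y \<noteq> y)) \<and>
      (\<forall>A\<^sub>0 \<in> K. \<forall>A\<^sub>1 \<in> K. \<forall>\<alpha> \<in> Iso A\<^sub>0 A\<^sub>1.
        H A\<^sub>0 A\<^sub>1 \<alpha> \<in> Iso (E A\<^sub>0) (E A\<^sub>1) \<and>
        (\<forall>x \<in> carr A\<^sub>0. H A\<^sub>0 A\<^sub>1 \<alpha> (\<eta> A\<^sub>0 x) = \<eta> A\<^sub>1 (\<alpha> x)) \<and>
        (\<forall>\<phi>\<^sub>0 \<in> Aut A\<^sub>0. \<forall>\<phi>\<^sub>1 \<in> Aut A\<^sub>1.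
          (\<forall>x \<in> carr A\<^sub>0. \<alpha> (\<phi>\<^sub>0 x) = \<phi>\<^sub>1 (\<alpha> x)) \<longrightarrow>
          (\<forall>y \<in> carr (E A\<^sub>0). H A\<^sub>0 A\<^sub>1 \<alpha> (T A\<^sub>0 \<phi>\<^sub>0 y) = T A\<^sub>1 \<phi>\<^sub>1 (H A\<^sub>0 A\<^sub>1 \<alpha> y)))))"


section \<open>Graphs and ordered graphs\<close>

definition graph_on :: "'v set \<Rightarrow> ('v \<Rightarrow> 'v \<Rightarrow> bool) \<Rightarrow> bool" where
  "graph_on V adj \<longleftrightarrow> symp_on V adj \<and> irreflp_on V adj"

definition K_free :: "nat \<Rightarrow> 'v set \<Rightarrow> ('v \<Rightarrow> 'v \<Rightarrow> bool) \<Rightarrow> bool" where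
  "K_free n V adj \<longleftrightarrow>
     \<not> (\<exists>S \<subseteq> V. finite S \<and> card S = n \<and> (\<forall>x \<in> S. \<forall>y \<in> S. x \<noteq> y \<longrightarrow> adj x y))"

datatype graph_sym = Adj
datatype ograph_sym = OLess | OAdj

instance graph_sym :: countable
  by countable_datatype

instance ograph_sym :: countable
  by countable_datatype

definition graph_ar :: "graph_sym \<Rightarrow> nat" where
  "graph_ar r = 2"

definition ograph_ar :: "ograph_sym \<Rightarrow> nat" where
  "ograph_ar r = 2"

definition graphs :: "graph_sym rstruct set" where
  "graphs = {A. is_struct graph_ar A \<and> graph_on (carr A) (\<lambda>x y. rel A Adj [x, y])}"

definition K_free_graphs :: "nat \<Rightarrow> graph_sym rstruct set" where
  "K_free_graphs n = {A \<in> graphs. K_free n (carr A) (\<lambda>x y. rel A Adj [x, y])}"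

definition ordered_graphs :: "ograph_sym rstruct set" where
  "ordered_graphs = {A. is_struct ograph_ar A \<and>
     strict_linear_order_on (carr A) {(x, y). rel A OLess [x, y]} \<and>
     graph_on (carr A) (\<lambda>x y. rel A OAdj [x, y])}"

definition K_free_ordered_graphs :: "nat \<Rightarrow> ograph_sym rstruct set" where
  "K_free_ordered_graphs n =
     {A \<in> ordered_graphs. K_free n (carr A) (\<lambda>x y. rel A OAdj [x, y])}"

end

theory Submission
  imports Defs
begin

text \<open>
  The extension of \<open>A\<close> consists of words in the letters \<open>A + \<int>\<close>, the vertex \<open>a\<close> of \<open>A\<close> being the
  one-letter word \<open>a\<close>. Every other word contains an integer; its letters after the first one that
  lie in \<open>A\<close> are its neighbours, and no two new words are adjacent. If \<open>K\<^sub>n\<close> is forbidden, the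
  neighbours have to form a \<open>K\<^sub>n\<^sub>-\<^sub>1\<close>-free set. Words are ordered lexicographically, with
  integers below the elements of \<open>A\<close>, so the first letter \<open>p\<close> puts a new word \<open>p 0 \<dots>\<close> immediately
  above \<open>p\<close>, or below all of \<open>A\<close> if \<open>p\<close> is an integer, and every finite cut of \<open>A\<close> is realized.
  Isomorphisms act letterwise on \<open>A\<close> and trivially on the integers; the lift of an automorphism also
  adds \<open>1\<close> to the integers. The shift moves every new word, preserves the order and commutes with
  letterwise action, which gives (b) and (c). Everything is defined by countable quantification over
  the code of \<open>A\<close>, hence Borel.
\<close>

section \<open>Borel maps between codes\<close>

text \<open>Coordinatewise measurability and pairing of Borel maps are available for second
  countable spaces, and codes of structures are built from \<open>bool\<close>-valued
  functions.\<close>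

instance bool :: second_countable_topology
proof
  show "\<exists>B::bool set set. countable B \<and> open = generate_topology B"
    by (intro exI[of _ UNIV] conjI)
      (auto simp: fun_eq_iff open_discrete intro: generate_topology.Basis)
qed

text \<open>Every subset of a countable Hausdorff space is Borel. This passes between Borel maps
  into \<open>bool\<close> or \<open>nat\<close> and the \<open>count_space\<close> form behind
  \<open>Measurable.pred\<close>.\<close>

lemma borel_measurable_iff_count_space:
  "f \<in> borel_measurable M \<longleftrightarrow> f \<in> M \<rightarrow>\<^sub>M count_space (UNIV :: 'a::{countable, t2_space} set)"
  by (rule arg_cong[where f = "\<lambda>S. f \<in> S"], rule measurable_cong_sets)
    (simp_all add: sets_borel_eq_count_space)

lemma borel_measurable_rstructI:
  fixes E :: "'a \<Rightarrow> 'r::countable rstruct"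
  assumes "\<And>y. Measurable.pred M (\<lambda>x. y \<in> carr (E x))"
    and "\<And>r ys. Measurable.pred M (\<lambda>x. rel (E x) r ys)"
  shows "E \<in> borel_measurable M"
proof -
  have "(\<lambda>x. fst (E x)) \<in> borel_measurable M"
    using assms(1) by (intro measurable_coordinatewise_then_product)
      (simp add: carr_def borel_measurable_iff_count_space)
  moreover have "(\<lambda>x. snd (E x)) \<in> borel_measurable M"
    using assms(2) by (intro measurable_coordinatewise_then_product)
      (simp add: rel_def borel_measurable_iff_count_space)
  ultimately have "(\<lambda>x. (fst (E x), snd (E x))) \<in> borel_measurable M"
    by (rule borel_measurable_Pair)
  then show ?thesis
    by simp
qed

lemma pred_carr:
  fixes E :: "'a \<Rightarrow> 'r::countable rstruct"
  assumes "E \<in> borel_measurable M"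
  shows "Measurable.pred M (\<lambda>x. y \<in> carr (E x))"
proof -
  have "fst \<in> borel_measurable (borel :: 'r rstruct measure)"
    by (intro borel_measurable_continuous_onI continuous_intros)
  from measurable_compose[OF assms this] show ?thesis
    by (auto simp: carr_def borel_measurable_iff_count_space[symmetric]
        intro: measurable_product_then_coordinatewise)
qed

lemma pred_rel:
  fixes E :: "'a \<Rightarrow> 'r::countable rstruct"
  assumes "E \<in> borel_measurable M"
  shows "Measurable.pred M (\<lambda>x. rel (E x) r ys)"
proof -
  have "snd \<in> borel_measurable (borel :: 'r rstruct measure)"
    by (intro borel_measurable_continuous_onI continuous_intros)
  from measurable_compose[OF assms this] show ?thesis
    by (auto simp: rel_def borel_measurable_iff_count_space[symmetric]
        intro!: measurable_product_then_coordinatewise)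
qed

text \<open>A clique of size \<open>n\<close> is enumerated by a distinct list of length
  \<open>n\<close>, and a countable type has only countably many lists; so the quantifier over sets
  becomes a countable one.\<close>

lemma pred_K_free:
  fixes R :: "'a \<Rightarrow> 'v::countable \<Rightarrow> 'v \<Rightarrow> bool"
  assumes [measurable]: "\<And>v. Measurable.pred M (\<lambda>x. v \<in> V x)"
    "\<And>v w. Measurable.pred M (\<lambda>x. R x v w)"
  shows "Measurable.pred M (\<lambda>x. K_free n (V x) (R x))"
proof -
  have "K_free n (V x) (R x) \<longleftrightarrow> \<not> (\<exists>vs. distinct vs \<and> length vs = n \<and>
      (\<forall>v. v \<in> set vs \<longrightarrow> v \<in> V x) \<and>
      (\<forall>v w. v \<in> set vs \<longrightarrow> w \<in> set vs \<longrightarrow> v \<noteq> w \<longrightarrow> R x v w))" for x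
    unfolding K_free_def
    by (safe; metis distinct_card finite_distinct_list List.finite_set subsetI in_mono)
  then show ?thesis
    by simp
qed


section \<open>Embeddings, isomorphisms and cliques\<close>

text \<open>Lists of length other than 2 satisfy no relation in either structure, so checking pairs
  suffices.\<close>

lemma EmbI_binary:
  assumes "is_struct (\<lambda>_. 2) A" "is_struct (\<lambda>_. 2) B"
    and "f \<in> carr A \<rightarrow>\<^sub>E carr B" "inj_on f (carr A)"
    and "\<And>r x y. x \<in> carr A \<Longrightarrow> y \<in> carr A \<Longrightarrow> rel B r [f x, f y] \<longleftrightarrow> rel A r [x, y]"
  shows "f \<in> Emb A B"
proof -
  have "rel B r (map f xs) \<longleftrightarrow> rel A r xs" if "xs \<in> lists (carr A)" for r xs
  proof (cases "length xs = 2")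
    case True
    then obtain x y where "xs = [x, y]"
      by (metis length_0_conv length_Suc_conv numeral_2_eq_2)
    then show ?thesis
      using that assms(5) by simp
  next
    case False
    then show ?thesis
      using assms(1,2) unfolding is_struct_def by (metis length_map)
  qed
  then show ?thesis
    using assms(3,4) unfolding Emb_def by blast
qed

lemma Emb_mem: "f \<in> Emb A B \<Longrightarrow> x \<in> carr A \<Longrightarrow> f x \<in> carr B"
  unfolding Emb_def by (auto dest: PiE_mem)

lemma Emb_inj: "f \<in> Emb A B \<Longrightarrow> inj_on f (carr A)"
  unfolding Emb_def by simp

lemma Emb_rel: "f \<in> Emb A B \<Longrightarrow> x \<in> carr A \<Longrightarrow> y \<in> carr A \<Longrightarrow> rel B r [f x, f y] \<longleftrightarrow> rel A r [x, y]"
  unfolding Emb_def by (auto dest!: spec[of _ r] bspec[of _ _ "[x, y]"])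

lemma Iso_imp_Emb: "f \<in> Iso A B \<Longrightarrow> f \<in> Emb A B"
  unfolding Iso_def by simp

lemma Iso_image: "f \<in> Iso A B \<Longrightarrow> f ` carr A = carr B"
  unfolding Iso_def by simp

lemma Iso_inv:
  assumes f: "f \<in> Iso A B"
  shows "restrict (inv_into (carr A) f) (carr B) \<in> Iso B A"
proof -
  let ?g = "restrict (inv_into (carr A) f) (carr B)"
  have bij: "bij_betw f (carr A) (carr B)"
    using f by (auto simp: bij_betw_def Iso_def Emb_def)
  have gB: "bij_betw ?g (carr B) (carr A)"
    using bij_betw_inv_into[OF bij] by (simp add: bij_betw_restrict_eq)
  have "rel A r (map ?g xs) \<longleftrightarrow> rel B r xs" if xs: "xs \<in> lists (carr B)" for r xs
  proof -
    have "map ?g xs \<in> lists (carr A)"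
      using xs bij_betwE[OF gB] by auto
    moreover have "map f (map ?g xs) = xs"
      using xs bij by (auto intro!: map_idI simp: bij_betw_inv_into_right in_lists_conv_set)
    ultimately show ?thesis
      using f unfolding Iso_def Emb_def by (metis (mono_tags, lifting) mem_Collect_eq)
  qed
  then show ?thesis
    using gB by (auto simp: Iso_def Emb_def bij_betw_def)
qed

text \<open>An injection that preserves and reflects adjacency matches cliques with cliques of the
  same size. It is applied to embeddings, to the coding of words by numbers, to one-letter words and
  to the renaming of letters.\<close>

lemma K_free_image:
  assumes "inj_on f V" and "\<And>x y. x \<in> V \<Longrightarrow> y \<in> V \<Longrightarrow> R' (f x) (f y) \<longleftrightarrow> R x y"
  shows "K_free n (f ` V) R' \<longleftrightarrow> K_free n V R"
proof -
  have inj: "inj_on f S" if "S \<subseteq> V" for S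
    using assms(1) that by (rule inj_on_subset)
  have "(\<exists>S\<subseteq>f ` V. finite S \<and> card S = n \<and> (\<forall>x\<in>S. \<forall>y\<in>S. x \<noteq> y \<longrightarrow> R' x y)) \<longleftrightarrow>
    (\<exists>S\<subseteq>V. finite (f ` S) \<and> card (f ` S) = n \<and> (\<forall>x\<in>f ` S. \<forall>y\<in>f ` S. x \<noteq> y \<longrightarrow> R' x y))"
    by (simp only: subset_image_iff) blast
  also have "\<dots> \<longleftrightarrow> (\<exists>S\<subseteq>V. finite S \<and> card S = n \<and> (\<forall>x\<in>S. \<forall>y\<in>S. x \<noteq> y \<longrightarrow> R x y))"
    using inj assms(2)
    by (intro ex_cong1 conj_cong refl)
      (auto simp: card_image finite_image_iff inj_on_eq_iff[OF assms(1)] subset_iff)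
  finally show ?thesis
    unfolding K_free_def by simp
qed

lemma K_free_mono: "K_free n V R \<Longrightarrow> U \<subseteq> V \<Longrightarrow> K_free n U R"
  unfolding K_free_def by blast


section \<open>Words\<close>

fun letter_lt :: "('a \<Rightarrow> 'a \<Rightarrow> bool) \<Rightarrow> 'a + int \<Rightarrow> 'a + int \<Rightarrow> bool" where
  "letter_lt R (Inl a) (Inl b) \<longleftrightarrow> R a b"
| "letter_lt R (Inl a) (Inr j) \<longleftrightarrow> False"
| "letter_lt R (Inr i) (Inl b) \<longleftrightarrow> True"
| "letter_lt R (Inr i) (Inr j) \<longleftrightarrow> i < j"

definition word_less :: "('a \<Rightarrow> 'a \<Rightarrow> bool) \<Rightarrow> (('a + int) list \<times> ('a + int) list) set" where
  "word_less R = lexord {(s, t). letter_lt R s t}"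

definition nbrs :: "('a + int) list \<Rightarrow> 'a set" where
  "nbrs w = Inl -` set (tl w)"

text \<open>Since \<open>nbrs\<close> is empty on one-letter words, old words are compared by
  \<open>R\<close> alone, and the last two disjuncts always join an old word to a word of another
  form.\<close>

definition word_adj :: "('a \<Rightarrow> 'a \<Rightarrow> bool) \<Rightarrow> ('a + int) list \<Rightarrow> ('a + int) list \<Rightarrow> bool" where
  "word_adj R u v \<longleftrightarrow> (\<exists>a b. u = [Inl a] \<and> v = [Inl b] \<and> R a b) \<or>
    (\<exists>a. u = [Inl a] \<and> a \<in> nbrs v) \<or> (\<exists>a. v = [Inl a] \<and> a \<in> nbrs u)"

lemma Inl_eq_map_sum_iff: "Inl b = map_sum f h s \<longleftrightarrow> (\<exists>a. s = Inl a \<and> b = f a)"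
  by (cases s) auto

lemma nbrs_map: "nbrs (map (map_sum f h) w) = f ` nbrs w"
  unfolding nbrs_def map_tl[symmetric] by (force simp: image_iff Inl_eq_map_sum_iff)

lemma nbrs_subset: "nbrs w \<subseteq> Inl -` set w"
  unfolding nbrs_def by (cases w) auto

lemma letter_lt_trans:
  assumes "trans {(a, b). R a b}"
  shows "trans {(s, t). letter_lt R s t}"
proof (rule transI, clarsimp)
  fix s t u
  assume "letter_lt R s t" "letter_lt R t u"
  then show "letter_lt R s u"
    using assms by (cases s; cases t; cases u) (auto dest: transD)
qed

lemma letter_lt_irrefl:
  assumes "irrefl {(a, b). R a b}"
  shows "\<not> letter_lt R s s"
  using assms by (cases s) (auto simp: irrefl_def)

text \<open>Stated relative to a set of letters because the order of a structure is total only on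
  its universe.\<close>

lemma total_on_lexord:
  assumes "total_on S r"
  shows "total_on (lists S) (lexord r)"
proof -
  have "u = v \<or> (u, v) \<in> lexord r \<or> (v, u) \<in> lexord r"
    if "u \<in> lists S" "v \<in> lists S" for u v
    using that
  proof (induction u arbitrary: v)
    case Nil
    then show ?case
      by (cases v) auto
  next
    case (Cons s u v)
    note IH = Cons.IH and uv = Cons.hyps Cons.prems
    show ?case
    proof (cases v)
      case v: (Cons t w)
      then have "s \<in> S" "t \<in> S"
        using uv by simp_all
      then have "s = t \<or> (s, t) \<in> r \<or> (t, s) \<in> r"
        using assms unfolding total_on_def by blast
      then show ?thesis
        using v IH[of w] uv by auto
    qed simp
  qed
  then show ?thesis
    unfolding total_on_def by blast
qed

text \<open>The lexicographic comparison skips equal letters and is decided at the first difference,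
  so the map on letters has to reflect equality as well as the order.\<close>

lemma lexord_map_iff:
  assumes "inj_on g S" and "\<And>s t. s \<in> S \<Longrightarrow> t \<in> S \<Longrightarrow> (g s, g t) \<in> r' \<longleftrightarrow> (s, t) \<in> r"
    and "u \<in> lists S" "v \<in> lists S"
  shows "(map g u, map g v) \<in> lexord r' \<longleftrightarrow> (u, v) \<in> lexord r"
  using assms(3,4)
proof (induction u arbitrary: v)
  case Nil
  then show ?case
    by (cases v) auto
next
  case (Cons s u v)
  then show ?case
    using assms(1,2) by (cases v) (auto simp: inj_on_eq_iff)
qed

lemma word_less_map:
  assumes "inj_on f V" and "\<And>x y. x \<in> V \<Longrightarrow> y \<in> V \<Longrightarrow> R' (f x) (f y) \<longleftrightarrow> R x y"
    and "strict_mono h" and "Inl -` set u \<subseteq> V" "Inl -` set v \<subseteq> V"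
  shows "(map (map_sum f h) u, map (map_sum f h) v) \<in> word_less R' \<longleftrightarrow> (u, v) \<in> word_less R"
  unfolding word_less_def
proof (rule lexord_map_iff)
  let ?S = "V <+> (UNIV :: int set)"
  show "inj_on (map_sum f h) ?S"
  proof (rule inj_onI)
    fix s t
    assume "s \<in> ?S" "t \<in> ?S" "map_sum f h s = map_sum f h t"
    then show "s = t"
      by (auto simp: inj_on_eq_iff[OF assms(1)] strict_mono_eq[OF assms(3)])
  qed
  show "(map_sum f h s, map_sum f h t) \<in> {(s, t). letter_lt R' s t} \<longleftrightarrow>
      (s, t) \<in> {(s, t). letter_lt R s t}" if "s \<in> ?S" "t \<in> ?S" for s t
    using that by (auto simp: assms(2) strict_mono_less[OF assms(3)])
  have "w \<in> lists ?S" if "Inl -` set w \<subseteq> V" for w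
  proof (rule in_listsI, rule ballI)
    fix s
    assume "s \<in> set w"
    then show "s \<in> ?S"
      using that by - (cases s; auto)
  qed
  then show "u \<in> lists ?S" "v \<in> lists ?S"
    using assms(4,5) by blast+
qed

lemma map_eq_old_iff: "map (map_sum f h) w = [Inl b] \<longleftrightarrow> (\<exists>a. w = [Inl a] \<and> b = f a)"
  by (auto simp: map_eq_Cons_conv Inl_eq_map_sum_iff eq_commute[of "map_sum f h _"])

lemma word_adj_map:
  assumes f: "inj_on f V" and R: "\<And>x y. x \<in> V \<Longrightarrow> y \<in> V \<Longrightarrow> R' (f x) (f y) \<longleftrightarrow> R x y"
    and V: "Inl -` set u \<subseteq> V" "Inl -` set v \<subseteq> V"
  shows "word_adj R' (map (map_sum f h) u) (map (map_sum f h) v) \<longleftrightarrow> word_adj R u v"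
proof -
  have "f a \<in> f ` nbrs w \<longleftrightarrow> a \<in> nbrs w" if "a \<in> V" "Inl -` set w \<subseteq> V" for a and w :: "('a + int) list"
    using that nbrs_subset[of w] by (intro inj_on_image_mem_iff[OF f]) auto
  then show ?thesis
    unfolding word_adj_def map_eq_old_iff nbrs_map using V R
    by (smt (verit) list.set_intros(1) subset_iff vimageI)
qed

text \<open>The two words are fixed and only \<open>R\<close> varies, so descending letter by letter
  leaves a finite Boolean combination of instances of \<open>R\<close>.\<close>

lemma pred_word_less:
  assumes [measurable]: "\<And>a b. Measurable.pred M (\<lambda>x. R x a b)"
  shows "Measurable.pred M (\<lambda>x. (u, v) \<in> word_less (R x))"
  unfolding word_less_def
proof (induction u arbitrary: v)
  case Nil
  then show ?case
    by simp
next
  case (Cons s u v)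
  have [measurable]: "Measurable.pred M (\<lambda>x. letter_lt (R x) s t)" for t
    by (cases s; cases t) simp_all
  note Cons[measurable]
  show ?case
    by (cases v) simp_all
qed

lemma pred_word_adj:
  fixes R :: "'a \<Rightarrow> 'v::countable \<Rightarrow> 'v \<Rightarrow> bool"
  assumes [measurable]: "\<And>a b. Measurable.pred M (\<lambda>x. R x a b)"
  shows "Measurable.pred M (\<lambda>x. word_adj (R x) u v)"
  unfolding word_adj_def by measurable

lemma measurable_map_map_sum:
  assumes [measurable]: "\<And>a. (\<lambda>x. f x a) \<in> M \<rightarrow>\<^sub>M count_space UNIV"
  shows "(\<lambda>x. map (map_sum (f x) h) (w :: ('v::countable + int) list) :: ('v + int) list)
    \<in> M \<rightarrow>\<^sub>M count_space UNIV"
proof (induction w)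
  case Nil
  then show ?case
    by simp
next
  case (Cons s w)
  have [measurable]: "(\<lambda>x. map_sum (f x) h s) \<in> M \<rightarrow>\<^sub>M count_space UNIV"
    by (cases s) simp_all
  note Cons[measurable]
  show ?case
    by simp
qed


section \<open>The extension\<close>

abbreviation related :: "'r rstruct \<Rightarrow> 'r \<Rightarrow> nat \<Rightarrow> nat \<Rightarrow> bool" where
  "related A r \<equiv> \<lambda>x y. rel A r [x, y]"

text \<open>
  The symbols other than \<open>adj\<close>, of which there is at most one, stand for linear orders, and \<open>N\<close> is
  the set of sizes of the forbidden cliques; so one locale covers all four classes.
\<close>

locale forbidden_cliques =
  fixes adj :: "'r::countable" and N :: "nat set"
  assumes order_unique: "r \<noteq> adj \<Longrightarrow> s \<noteq> adj \<Longrightarrow> r = s"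
    and N_pos: "n \<in> N \<Longrightarrow> n > 0"
begin

definition cls :: "'r rstruct set" where
  "cls = {A. is_struct (\<lambda>_. 2) A \<and> graph_on (carr A) (related A adj) \<and>
    (\<forall>n \<in> N. K_free n (carr A) (related A adj)) \<and>
    (\<forall>r. r \<noteq> adj \<longrightarrow> strict_linear_order_on (carr A) {(x, y). rel A r [x, y]})}"

text \<open>The integer letter separates new words from old ones and gives the shift something to
  move; the empty word is thereby excluded. If \<open>1\<close> is in \<open>N\<close>, there are no
  new words, because the empty set is a clique of size 0.\<close>

definition words :: "'r rstruct \<Rightarrow> (nat + int) list set" where
  "words A = {w. (\<exists>a \<in> carr A. w = [Inl a]) \<or>
    Inl -` set w \<subseteq> carr A \<and> (\<exists>i. Inr i \<in> set w) \<and>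
    (\<forall>n \<in> N. K_free (n - 1) (nbrs w) (related A adj))}"

definition word_rel :: "'r \<Rightarrow> (nat \<Rightarrow> nat \<Rightarrow> bool) \<Rightarrow> (nat + int) list \<Rightarrow> (nat + int) list \<Rightarrow> bool" where
  "word_rel r R u v \<longleftrightarrow> (if r = adj then word_adj R u v else (u, v) \<in> word_less R)"

definition ext :: "'r rstruct \<Rightarrow> 'r rstruct" where
  "ext A = (\<lambda>y. y \<in> to_nat ` words A,
    \<lambda>r ys. \<exists>u \<in> words A. \<exists>v \<in> words A. ys = [to_nat u, to_nat v] \<and> word_rel r (related A r) u v)"

definition incl :: "'r rstruct \<Rightarrow> nat \<Rightarrow> nat" where
  "incl A = (\<lambda>x \<in> carr A. to_nat [Inl x :: nat + int])"

text \<open>The action \<open>h\<close> on integers is a parameter so that one construction serves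
  twice: with \<open>id\<close> for isomorphisms, and with the shift for the fixed-point-free
  extension of automorphisms.\<close>

definition lift :: "(int \<Rightarrow> int) \<Rightarrow> 'r rstruct \<Rightarrow> (nat \<Rightarrow> nat) \<Rightarrow> nat \<Rightarrow> nat" where
  "lift h A f = (\<lambda>y \<in> carr (ext A). to_nat (map (map_sum f h) (from_nat y)))"

section \<open>Consequences of membership in the class, and passage to embedded structures\<close>

lemma cls_struct: "A \<in> cls \<Longrightarrow> is_struct (\<lambda>_. 2) A"
  and cls_graph: "A \<in> cls \<Longrightarrow> graph_on (carr A) (related A adj)"
  and cls_K_free: "A \<in> cls \<Longrightarrow> n \<in> N \<Longrightarrow> K_free n (carr A) (related A adj)"
  and cls_order: "A \<in> cls \<Longrightarrow> r \<noteq> adj \<Longrightarrow> strict_linear_order_on (carr A) {(x, y). rel A r [x, y]}"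
  unfolding cls_def by auto

lemma rel_carr:
  assumes "A \<in> cls" "rel A r [x, y]"
  shows "x \<in> carr A" "y \<in> carr A"
  using cls_struct[OF assms(1)] assms(2) unfolding is_struct_def by fastforce+

lemma rel_irrefl:
  assumes A: "A \<in> cls"
  shows "\<not> rel A r [x, x]"
proof (cases "r = adj")
  case True
  then show ?thesis
    using cls_graph[OF A] rel_carr[OF A] unfolding graph_on_def irreflp_on_def by blast
next
  case False
  then show ?thesis
    using cls_order[OF A False] unfolding strict_linear_order_on_def irrefl_def by blast
qed

lemma adj_sym: "A \<in> cls \<Longrightarrow> rel A adj [x, y] \<longleftrightarrow> rel A adj [y, x]"
  using cls_graph[of A] rel_carr[of A adj] unfolding graph_on_def symp_on_def by blast

lemma order_trans: "A \<in> cls \<Longrightarrow> r \<noteq> adj \<Longrightarrow> rel A r [x, y] \<Longrightarrow> rel A r [y, z] \<Longrightarrow> rel A r [x, z]"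
  using cls_order[of A r] unfolding strict_linear_order_on_def trans_def by blast

lemma order_total:
  "A \<in> cls \<Longrightarrow> r \<noteq> adj \<Longrightarrow> x \<in> carr A \<Longrightarrow> y \<in> carr A \<Longrightarrow> x \<noteq> y \<Longrightarrow> rel A r [x, y] \<or> rel A r [y, x]"
  using cls_order[of A r] unfolding strict_linear_order_on_def total_on_def by blast

text \<open>All defining conditions are universal, hence inherited along embeddings. Closure under
  isomorphism follows from this.\<close>

lemma cls_hereditary:
  assumes A: "A \<in> cls" and B: "is_struct (\<lambda>_. 2) B" and f: "f \<in> Emb B A"
  shows "B \<in> cls"
proof -
  have carr: "x \<in> carr B \<and> y \<in> carr B" if "rel B r [x, y]" for r x y
    using B that unfolding is_struct_def by fastforce
  have rel: "rel B r [x, y] \<longleftrightarrow> x \<in> carr B \<and> y \<in> carr B \<and> rel A r [f x, f y]" for r x y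
    using carr Emb_rel[OF f] by blast
  have "graph_on (carr B) (related B adj)"
    using rel adj_sym[OF A] rel_irrefl[OF A]
    by (auto simp: graph_on_def symp_on_def irreflp_on_def)
  moreover have "K_free n (carr B) (related B adj)" if "n \<in> N" for n
  proof -
    have "K_free n (f ` carr B) (related A adj)"
      using cls_K_free[OF A that] by (rule K_free_mono) (auto intro: Emb_mem[OF f])
    then show ?thesis
      using K_free_image[OF Emb_inj[OF f], of "related A adj" "related B adj" n] Emb_rel[OF f]
      by simp
  qed
  moreover have "strict_linear_order_on (carr B) {(x, y). rel B r [x, y]}" if "r \<noteq> adj" for r
    unfolding strict_linear_order_on_def
  proof (intro conjI)
    show "trans {(x, y). rel B r [x, y]}"
      using rel order_trans[OF A that] unfolding trans_def by blast
    show "irrefl {(x, y). rel B r [x, y]}"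
      using rel rel_irrefl[OF A] unfolding irrefl_def by blast
    show "total_on (carr B) {(x, y). rel B r [x, y]}"
      using rel order_total[OF A that] Emb_mem[OF f] inj_on_eq_iff[OF Emb_inj[OF f]]
      unfolding total_on_def by blast
  qed
  ultimately show ?thesis
    using B unfolding cls_def by blast
qed

section \<open>The extension belongs to the class\<close>

lemma words_letters: "w \<in> words A \<Longrightarrow> Inl -` set w \<subseteq> carr A"
  unfolding words_def by auto

lemma old_in_words: "a \<in> carr A \<Longrightarrow> [Inl a] \<in> words A"
  unfolding words_def by simp

lemma word_rel_old: "word_rel r R [Inl a] [Inl b] \<longleftrightarrow> R a b"
  unfolding word_rel_def word_adj_def word_less_def nbrs_def by simp

lemma carr_ext: "carr (ext A) = to_nat ` words A"
  unfolding carr_def ext_def by simp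

lemma rel_ext_iff: "rel (ext A) r ys \<longleftrightarrow>
    (\<exists>u \<in> words A. \<exists>v \<in> words A. ys = [to_nat u, to_nat v] \<and> word_rel r (related A r) u v)"
  unfolding rel_def ext_def by simp

lemma rel_ext:
  "u \<in> words A \<Longrightarrow> v \<in> words A \<Longrightarrow>
    rel (ext A) r [to_nat u, to_nat v] \<longleftrightarrow> word_rel r (related A r) u v"
  unfolding rel_ext_iff by simp

lemma is_struct_ext: "is_struct (\<lambda>_. 2) (ext A)"
  unfolding is_struct_def rel_ext_iff carr_ext by auto

text \<open>New words are pairwise non-adjacent, so a clique contains at most one of them. Removing
  it leaves a clique of size \<open>n - 1\<close> among its neighbours, which \<open>words\<close>
  forbids; a clique without new words is a clique of \<open>A\<close>.\<close>

lemma K_free_words: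
  assumes A: "A \<in> cls" and n: "n \<in> N"
  shows "K_free n (words A) (word_adj (related A adj))"
proof -
  have old: "K_free m ((\<lambda>a. [Inl a]) ` F) (word_adj (related A adj)) \<longleftrightarrow> K_free m F (related A adj)" for m F
    by (rule K_free_image) (auto simp: inj_on_def word_adj_def nbrs_def)
  have False if S: "S \<subseteq> words A" "finite S" "card S = n"
    and clique: "\<And>u v. u \<in> S \<Longrightarrow> v \<in> S \<Longrightarrow> u \<noteq> v \<Longrightarrow> word_adj (related A adj) u v" for S
  proof (cases "\<exists>w \<in> S. \<exists>i. Inr i \<in> set w")
    case True
    then obtain w i where w: "w \<in> S" "Inr i \<in> set w"
      by blast
    then have new: "w \<noteq> [Inl a]" for a
      by auto
    then have "K_free (n - 1) (nbrs w) (related A adj)"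
      using w S(1) n unfolding words_def by blast
    \<comment> \<open>The word \<open>w\<close> is new, so whatever is adjacent to it is an old word
      whose letter lies in \<open>nbrs w\<close>.\<close>
    moreover have "S - {w} \<subseteq> (\<lambda>a. [Inl a]) ` nbrs w"
      using clique[of w] w new unfolding word_adj_def by blast
    moreover have "card (S - {w}) = n - 1"
      using S w by simp
    ultimately show False
      using clique S(2) unfolding old[symmetric] K_free_def by (metis Diff_iff finite_Diff)
  next
    case False
    then have "S \<subseteq> (\<lambda>a. [Inl a]) ` carr A"
      using S(1) unfolding words_def by blast
    then show False
      using cls_K_free[OF A n] clique S(2,3) unfolding old[symmetric] K_free_def by blast
  qed
  then show ?thesis
    unfolding K_free_def by blast
qed

lemma word_less_strict_linear:
  assumes A: "A \<in> cls" and r: "r \<noteq> adj"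
  shows "trans (word_less (related A r))" "(w, w) \<notin> word_less (related A r)"
    and "total_on (words A) (word_less (related A r))"
proof -
  have "trans {(x, y). rel A r [x, y]}" and irr: "irrefl {(x, y). rel A r [x, y]}"
    using cls_order[OF A r] unfolding strict_linear_order_on_def by simp_all
  from letter_lt_trans[OF this(1)] show "trans (word_less (related A r))"
    unfolding word_less_def by (rule lexord_transI)
  from letter_lt_irrefl[OF irr] show "(w, w) \<notin> word_less (related A r)"
    unfolding word_less_def by (intro lexord_irreflexive) simp
  let ?S = "carr A <+> (UNIV :: int set)"
  have "s = t \<or> letter_lt (related A r) s t \<or> letter_lt (related A r) t s"
    if "s \<in> ?S" "t \<in> ?S" for s t
    using that by (elim PlusE) (simp_all, metis order_total[OF A r], linarith)
  then have "total_on ?S {(s, t). letter_lt (related A r) s t}"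
    unfolding total_on_def by blast
  from total_on_lexord[OF this] show "total_on (words A) (word_less (related A r))"
    unfolding word_less_def
  proof (rule total_on_subset)
    show "words A \<subseteq> lists ?S"
    proof (rule subsetI, rule in_listsI, rule ballI)
      fix w s
      assume "w \<in> words A" "s \<in> set w"
      then show "s \<in> ?S"
        using words_letters[of w A] by - (cases s; auto)
    qed
  qed
qed

lemma ext_in_cls:
  assumes A: "A \<in> cls"
  shows "ext A \<in> cls"
proof -
  have "\<not> word_adj (related A adj) w w" if "w \<in> words A" for w
    using rel_irrefl[OF A] unfolding word_adj_def nbrs_def by auto
  moreover have "word_adj (related A adj) v u" if "word_adj (related A adj) u v" for u v
    using that adj_sym[OF A] unfolding word_adj_def by blast
  ultimately have "graph_on (carr (ext A)) (related (ext A) adj)"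
    by (auto simp: graph_on_def symp_on_def irreflp_on_def carr_ext rel_ext word_rel_def)
  moreover have "K_free n (carr (ext A)) (related (ext A) adj)" if "n \<in> N" for n
    using K_free_image[of to_nat "words A" "related (ext A) adj" "word_adj (related A adj)" n]
      K_free_words[OF A that]
    by (simp add: carr_ext rel_ext word_rel_def)
  moreover have "strict_linear_order_on (carr (ext A)) {(x, y). rel (ext A) r [x, y]}"
    if r: "r \<noteq> adj" for r
    unfolding strict_linear_order_on_def
  proof (intro conjI)
    note o = word_less_strict_linear[OF A r]
    have rel: "rel (ext A) r [x, y] \<longleftrightarrow> (\<exists>u \<in> words A. \<exists>v \<in> words A.
        x = to_nat u \<and> y = to_nat v \<and> (u, v) \<in> word_less (related A r))" for x y
      using r by (auto simp: rel_ext_iff word_rel_def)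
    show "trans {(x, y). rel (ext A) r [x, y]}"
      using transD[OF o(1)] by (auto simp: rel intro!: transI)
    show "irrefl {(x, y). rel (ext A) r [x, y]}"
      using o(2) by (auto simp: rel irrefl_def)
    show "total_on (carr (ext A)) {(x, y). rel (ext A) r [x, y]}"
      using o(3) by (auto simp: rel carr_ext total_on_def)
  qed
  ultimately show ?thesis
    using is_struct_ext unfolding cls_def by blast
qed

lemma incl_Emb:
  assumes "A \<in> cls"
  shows "incl A \<in> Emb A (ext A)"
  using cls_struct[OF assms] is_struct_ext
proof (rule EmbI_binary)
  show "incl A \<in> carr A \<rightarrow>\<^sub>E carr (ext A)"
    by (auto simp: incl_def carr_ext old_in_words)
  show "inj_on (incl A) (carr A)"
    by (auto simp: incl_def inj_on_def)
  show "rel (ext A) r [incl A x, incl A y] \<longleftrightarrow> rel A r [x, y]" if "x \<in> carr A" "y \<in> carr A" for r x y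
    using that by (simp add: incl_def rel_ext old_in_words word_rel_old)
qed


section \<open>Witnesses\<close>

text \<open>Induction on formulas; as all symbols are binary, agreement on equalities and on pairs
  of terms over \<open>P\<close> covers the atomic case.\<close>

lemma sat_transfer:
  assumes "\<And>s t. set_tm s \<subseteq> P \<Longrightarrow> set_tm t \<subseteq> P \<Longrightarrow>
      (tm_val f b s = tm_val f b t \<longleftrightarrow> tm_val f' b' s = tm_val f' b' t) \<and>
      (\<forall>r. rel B r [tm_val f b s, tm_val f b t] \<longleftrightarrow> rel B' r [tm_val f' b' s, tm_val f' b' t])"
    and "wf_qf (\<lambda>_. 2) p" "pars p \<subseteq> P"
  shows "sat B f b p \<longleftrightarrow> sat B' f' b' p"
  using assms(2,3)
proof (induction p)
  case (Eq s t)
  then show ?case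
    using assms(1) by simp
next
  case (Rel r ts)
  then obtain s t where "ts = [s, t]"
    by (auto simp: length_Suc_conv numeral_2_eq_2)
  then show ?case
    using Rel assms(1)[of s t] by simp
qed auto

text \<open>Only relations between the realizing element and a parameter need comparing: two
  parameters are related as in \<open>A\<close> on both sides, and no element is related to
  itself.\<close>

lemma realizes_transfer:
  assumes B: "B \<in> cls" "B' \<in> cls" and f: "f \<in> Emb A B" "f' \<in> Emb A B'"
    and b: "b' \<in> carr B'" and P: "P \<subseteq> carr A"
    and eq: "\<And>a. a \<in> P \<Longrightarrow> f a = b \<longleftrightarrow> f' a = b'"
    and rels: "\<And>a r. a \<in> P \<Longrightarrow> rel B r [f a, b] \<longleftrightarrow> rel B' r [f' a, b']"
      "\<And>a r. a \<in> P \<Longrightarrow> rel B r [b, f a] \<longleftrightarrow> rel B' r [b', f' a]"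
    and \<tau>: "\<And>p. p \<in> \<tau> \<Longrightarrow> wf_qf (\<lambda>_. 2) p \<and> pars p \<subseteq> P"
    and "realizes B f b \<tau>"
  shows "realizes B' f' b' \<tau>"
proof -
  have "(tm_val f b s = tm_val f b t \<longleftrightarrow> tm_val f' b' s = tm_val f' b' t) \<and>
      (\<forall>r. rel B r [tm_val f b s, tm_val f b t] \<longleftrightarrow> rel B' r [tm_val f' b' s, tm_val f' b' t])"
    if "set_tm s \<subseteq> P" "set_tm t \<subseteq> P" for s t
    using that P eq rels rel_irrefl[OF B(1)] rel_irrefl[OF B(2)]
      Emb_rel[OF f(1)] Emb_rel[OF f(2)] inj_on_eq_iff[OF Emb_inj[OF f(1)]] inj_on_eq_iff[OF Emb_inj[OF f(2)]]
    by (cases s; cases t) (auto simp: subset_iff eq_commute[of b] eq_commute[of b'])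
  then show ?thesis
    using sat_transfer[of P f b f' b' B B'] \<tau> b assms(11) unfolding realizes_def by blast
qed

text \<open>The letter \<open>p\<close> records the cut of \<open>b\<close> over \<open>P\<close>:
  it is the largest parameter below \<open>b\<close>, or an integer if there is none. A word
  starting with \<open>p\<close> and having further letters lies above \<open>[p]\<close>, whence
  the disjunct \<open>p = Inl a\<close>.\<close>

lemma position_exists:
  assumes A: "A \<in> cls" and B: "B \<in> cls" and f: "f \<in> Emb A B" and b: "b \<in> carr B - f ` carr A"
    and P: "finite P" "P \<subseteq> carr A"
  obtains p :: "nat + int" where "p = Inr 0 \<or> p \<in> Inl ` P"
    and "\<And>a r. r \<noteq> adj \<Longrightarrow> a \<in> P \<Longrightarrow>
      (rel B r [f a, b] \<longleftrightarrow> letter_lt (related A r) (Inl a) p \<or> p = Inl a) \<and>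
      (rel B r [b, f a] \<longleftrightarrow> letter_lt (related A r) p (Inl a))"
proof (cases "\<exists>r a. r \<noteq> adj \<and> a \<in> P \<and> rel B r [f a, b]")
  \<comment> \<open>This includes languages without an order symbol. The letter \<open>Inr 0\<close>
    lies below every letter from \<open>A\<close>.\<close>
  case False
  then have "rel B r [b, f a]" if "r \<noteq> adj" "a \<in> P" for a r
    using that b P order_total[OF B, of r b "f a"] Emb_mem[OF f] by blast
  then show ?thesis
    using False by (intro that[of "Inr 0"]) auto
next
  case True
  then obtain r where r: "r \<noteq> adj" and "\<exists>a \<in> P. rel B r [f a, b]"
    by blast
  moreover have "finite {a \<in> P. rel B r [f a, b]}"
    using P by simp
  moreover have "transp_on D (related A r)" "asymp_on D (related A r)" for D
    using order_trans[OF A r] rel_irrefl[OF A] by (blast intro: transp_onI asymp_onI)+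
  ultimately obtain m where m: "m \<in> P" "rel B r [f m, b]"
    and max: "\<And>a. a \<in> P \<Longrightarrow> rel B r [f a, b] \<Longrightarrow> a \<noteq> m \<Longrightarrow> \<not> rel A r [m, a]"
    using Finite_Set.bex_max_element[of "{a \<in> P. rel B r [f a, b]}" "related A r"] by blast
  have max': "rel A r [a, m]" if "a \<in> P" "rel B r [f a, b]" "a \<noteq> m" for a
    using max[OF that] that order_total[OF A r, of a m] m(1) P(2) by blast
  have "(rel B s [f a, b] \<longleftrightarrow> rel A s [a, m] \<or> m = a) \<and> (rel B s [b, f a] \<longleftrightarrow> rel A s [m, a])"
    if s: "s \<noteq> adj" and a: "a \<in> P" for a s
  proof -
    \<comment> \<open>The maximum \<open>m\<close> was taken with respect to \<open>r\<close>; it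
      serves all order symbols because there is only one.\<close>
    have [simp]: "s = r"
      using order_unique s r by blast
    have am: "rel B r [f a, f m] \<longleftrightarrow> rel A r [a, m]" "rel B r [f m, f a] \<longleftrightarrow> rel A r [m, a]"
      using Emb_rel[OF f] a m(1) P(2) by blast+
    have "rel B r [f a, b] \<or> rel B r [b, f a]"
      using b a P Emb_mem[OF f] by (intro order_total[OF B r]) auto
    then show ?thesis
      using am m max'[OF a] order_trans[OF B r] rel_irrefl[OF B] by simp metis
  qed
  then show ?thesis
    using m(1) by (intro that[of "Inl m"]) auto
qed

text \<open>The word consists of the position of \<open>b\<close>, an integer, and the parameters
  adjacent to \<open>b\<close>. It is allowed because a clique of size \<open>n - 1\<close> among
  these parameters would, together with \<open>b\<close>, form a clique of size \<open>n\<close> in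
  \<open>B\<close>.\<close>

lemma witness_exists:
  assumes A: "A \<in> cls" and B: "B \<in> cls" and f: "f \<in> Emb A B" and b: "b \<in> carr B - f ` carr A"
    and P: "finite P" "P \<subseteq> carr A"
  obtains w where "w \<in> words A" "\<And>a. w \<noteq> [Inl a]"
    "\<And>a r. a \<in> P \<Longrightarrow> (rel B r [f a, b] \<longleftrightarrow> word_rel r (related A r) [Inl a] w) \<and>
      (rel B r [b, f a] \<longleftrightarrow> word_rel r (related A r) w [Inl a])"
proof -
  obtain p :: "nat + int" where p: "p = Inr 0 \<or> p \<in> Inl ` P"
    and less: "\<And>a r. r \<noteq> adj \<Longrightarrow> a \<in> P \<Longrightarrow>
      (rel B r [f a, b] \<longleftrightarrow> letter_lt (related A r) (Inl a) p \<or> p = Inl a) \<and>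
      (rel B r [b, f a] \<longleftrightarrow> letter_lt (related A r) p (Inl a))"
    using position_exists[OF assms] by blast
  obtain xs where xs: "set xs = {a \<in> P. rel B adj [b, f a]}"
    using P(1) finite_list[of "{a \<in> P. rel B adj [b, f a]}"] by auto
  \<comment> \<open>The second letter makes \<open>w\<close> new even if \<open>p\<close> is a
    parameter and \<open>xs\<close> is empty, and puts \<open>w\<close> strictly above
    \<open>[p]\<close>. The first letter is not counted by \<open>nbrs\<close>, so position and
    adjacency are chosen independently.\<close>
  define w where "w = p # Inr 0 # map Inl xs"
  have nbrs: "nbrs w = set xs"
    unfolding nbrs_def w_def by auto
  have "K_free (n - 1) (set xs) (related A adj)" if n: "n \<in> N" for n
    unfolding K_free_def
  proof safe
    fix S
    assume S: "S \<subseteq> set xs" "finite S" "card S = n - 1"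
      and clique: "\<forall>x \<in> S. \<forall>y \<in> S. x \<noteq> y \<longrightarrow> rel A adj [x, y]"
    have SA: "S \<subseteq> carr A"
      using S(1) xs P by blast
    have "card (f ` S) = n - 1"
      using S(3) inj_on_subset[OF Emb_inj[OF f] SA] by (simp add: card_image)
    \<comment> \<open>Positivity of \<open>n\<close> turns \<open>Suc (n - 1)\<close> back into
      \<open>n\<close>.\<close>
    then have "card (insert b (f ` S)) = n"
      using b SA S(2) N_pos[OF n] by (subst card_insert_disjoint) auto
    moreover have "insert b (f ` S) \<subseteq> carr B"
      using b SA Emb_mem[OF f] by blast
    moreover have "rel B adj [x, y]"
      if xy: "x \<in> insert b (f ` S)" "y \<in> insert b (f ` S)" "x \<noteq> y" for x y
    proof -
      have "rel B adj [b, f a]" "rel B adj [f a, b]" if "a \<in> S" for a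
        using that S(1) xs adj_sym[OF B] by blast+
      moreover have "rel B adj [f a, f a']" if "a \<in> S" "a' \<in> S" "a \<noteq> a'" for a a'
        using that clique SA Emb_rel[OF f] by blast
      ultimately show ?thesis
        using xy by blast
    qed
    ultimately show False
      using cls_K_free[OF B n] S(2) unfolding K_free_def by blast
  qed
  then have "w \<in> words A"
    using p P xs nbrs unfolding words_def by (auto simp: w_def)
  moreover have "(rel B r [f a, b] \<longleftrightarrow> word_rel r (related A r) [Inl a] w) \<and>
      (rel B r [b, f a] \<longleftrightarrow> word_rel r (related A r) w [Inl a])" if a: "a \<in> P" for a r
  proof (cases "r = adj")
    case True
    have "word_adj R [Inl a] w \<longleftrightarrow> a \<in> set xs" "word_adj R w [Inl a] \<longleftrightarrow> a \<in> set xs" for R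
      unfolding word_adj_def nbrs by (auto simp: w_def nbrs_def)
    then show ?thesis
      using True a xs adj_sym[OF B] by (simp add: word_rel_def)
  next
    case False
    then show ?thesis
      using less[OF False a] by (auto simp: word_rel_def word_less_def w_def)
  qed
  ultimately show ?thesis
    using that[of w] by (simp add: w_def)
qed

text \<open>A realization inside the image of \<open>A\<close> is already present in
  \<open>A\<close>; any other one is imitated by the word from
  \<open>witness_exists\<close>.\<close>

lemma ext_realizes:
  assumes A: "A \<in> cls" and "admissible_type (\<lambda>_. 2) cls A \<tau>"
  shows "\<exists>c. realizes (ext A) (incl A) c \<tau>"
proof -
  obtain B f b where B: "B \<in> cls" and f: "f \<in> Emb A B" and re: "realizes B f b \<tau>"
    and fin: "finite_type (\<lambda>_. 2) A \<tau>"
    using assms(2) unfolding admissible_type_def by blast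
  define P where "P = (\<Union>p \<in> \<tau>. pars p)"
  have P: "finite P" "P \<subseteq> carr A" and \<tau>: "\<And>p. p \<in> \<tau> \<Longrightarrow> wf_qf (\<lambda>_. 2) p \<and> pars p \<subseteq> P"
    using fin unfolding finite_type_def P_def by auto
  note tr = realizes_transfer[OF B ext_in_cls[OF A] f incl_Emb[OF A] _ P(2) _ _ _ \<tau> re]
  have bB: "b \<in> carr B"
    using re unfolding realizes_def by simp
  show ?thesis
  proof (cases "b \<in> f ` carr A")
    case True
    then obtain c where c: "c \<in> carr A" "b = f c"
      by blast
    have "realizes (ext A) (incl A) (incl A c) \<tau>"
    proof (rule tr)
      show "incl A c \<in> carr (ext A)"
        using c Emb_mem[OF incl_Emb[OF A]] by blast
      fix a
      assume "a \<in> P"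
      then have a: "a \<in> carr A"
        using P by blast
      show "f a = b \<longleftrightarrow> incl A a = incl A c"
        using a c inj_on_eq_iff[OF Emb_inj[OF f]] inj_on_eq_iff[OF Emb_inj[OF incl_Emb[OF A]]] by simp
      show "rel B r [f a, b] \<longleftrightarrow> rel (ext A) r [incl A a, incl A c]" for r
        using a c Emb_rel[OF f] Emb_rel[OF incl_Emb[OF A]] by simp
      show "rel B r [b, f a] \<longleftrightarrow> rel (ext A) r [incl A c, incl A a]" for r
        using a c Emb_rel[OF f] Emb_rel[OF incl_Emb[OF A]] by simp
    qed
    then show ?thesis
      by blast
  next
    case False
    with bB have "b \<in> carr B - f ` carr A"
      by blast
    then obtain w where w: "w \<in> words A" "\<And>a. w \<noteq> [Inl a]"
      and rels: "\<And>a r. a \<in> P \<Longrightarrow> (rel B r [f a, b] \<longleftrightarrow> word_rel r (related A r) [Inl a] w) \<and>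
        (rel B r [b, f a] \<longleftrightarrow> word_rel r (related A r) w [Inl a])"
      using witness_exists[OF A B f _ P] by blast
    have "realizes (ext A) (incl A) (to_nat w) \<tau>"
    proof (rule tr)
      show "to_nat w \<in> carr (ext A)"
        using w by (simp add: carr_ext)
      fix a
      assume aP: "a \<in> P"
      then have a: "a \<in> carr A"
        using P by blast
      show "f a = b \<longleftrightarrow> incl A a = to_nat w"
        using False a w(2)[of a] by (auto simp: incl_def)
      show "rel B r [f a, b] \<longleftrightarrow> rel (ext A) r [incl A a, to_nat w]" for r
        using rels[OF aP] a w(1) by (simp add: incl_def rel_ext old_in_words)
      show "rel B r [b, f a] \<longleftrightarrow> rel (ext A) r [to_nat w, incl A a]" for r
        using rels[OF aP] a w(1) by (simp add: incl_def rel_ext old_in_words)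
    qed
    then show ?thesis
      by blast
  qed
qed


section \<open>Lifting isomorphisms\<close>

lemma map_in_words:
  assumes f: "f \<in> Iso A B" and w: "w \<in> words A"
  shows "map (map_sum f h) w \<in> words B"
proof (cases "\<exists>a \<in> carr A. w = [Inl a]")
  case True
  then show ?thesis
    using Emb_mem[OF Iso_imp_Emb[OF f]] by (auto simp: old_in_words)
next
  case False
  then have letters: "Inl -` set w \<subseteq> carr A" and new: "\<exists>i. Inr i \<in> set w"
    and free: "\<And>n. n \<in> N \<Longrightarrow> K_free (n - 1) (nbrs w) (related A adj)"
    using w unfolding words_def by auto
  have nA: "nbrs w \<subseteq> carr A"
    using nbrs_subset letters by (rule subset_trans)
  have "K_free (n - 1) (nbrs (map (map_sum f h) w)) (related B adj)" if "n \<in> N" for n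
    unfolding nbrs_map
  proof (subst K_free_image)
    show "inj_on f (nbrs w)"
      using inj_on_subset[OF Emb_inj[OF Iso_imp_Emb[OF f]] nA] .
    show "rel B adj [f x, f y] \<longleftrightarrow> rel A adj [x, y]" if "x \<in> nbrs w" "y \<in> nbrs w" for x y
      using that nA by (intro Emb_rel[OF Iso_imp_Emb[OF f]]) auto
  qed (rule free[OF that])
  moreover have "Inl -` set (map (map_sum f h) w) \<subseteq> carr B"
    using letters
    by (auto simp: Inl_eq_map_sum_iff subset_iff intro!: Emb_mem[OF Iso_imp_Emb[OF f]])
  moreover have "\<exists>i. Inr i \<in> set (map (map_sum f h) w)"
    using new by (metis image_eqI map_sum.simps(2) set_map)
  ultimately show ?thesis
    unfolding words_def by blast
qed

lemma lift_to_nat: "w \<in> words A \<Longrightarrow> lift h A f (to_nat w) = to_nat (map (map_sum f h) w)"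
  unfolding lift_def carr_ext by simp

text \<open>Letterwise application of \<open>f\<close> and \<open>h\<close> preserves adjacency
  through \<open>f\<close>, and the lexicographic order because \<open>h\<close> is monotone;
  inverting both letterwise gives bijectivity.\<close>

lemma lift_Iso:
  assumes f: "f \<in> Iso A B" and h: "strict_mono h" "surj h"
  shows "lift h A f \<in> Iso (ext A) (ext B)"
proof -
  note e = Iso_imp_Emb[OF f]
  have h_inj: "inj h"
    using h(1) by (rule strict_mono_imp_inj_on)
  have map_inj: "inj_on (map (map_sum f h)) (words A)"
  proof (rule inj_on_inverseI)
    fix w
    assume w: "w \<in> words A"
    have "map_sum (inv_into (carr A) f) (inv h) (map_sum f h s) = s" if "s \<in> set w" for s
      using that words_letters[OF w] Emb_inj[OF e] h_inj by - (cases s; auto)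
    then show "map (map_sum (inv_into (carr A) f) (inv h)) (map (map_sum f h) w) = w"
      by (simp add: map_idI)
  qed
  have "lift h A f \<in> Emb (ext A) (ext B)"
  proof (rule EmbI_binary[OF is_struct_ext is_struct_ext])
    show "lift h A f \<in> carr (ext A) \<rightarrow>\<^sub>E carr (ext B)"
      using map_in_words[OF f] by (auto simp: lift_def carr_ext)
    show "inj_on (lift h A f) (carr (ext A))"
      using map_inj by (auto simp: inj_on_def carr_ext lift_to_nat)
    have "word_rel r (related B r) (map (map_sum f h) u) (map (map_sum f h) v) \<longleftrightarrow>
        word_rel r (related A r) u v" if "u \<in> words A" "v \<in> words A" for r u v
      using that words_letters Emb_inj[OF e] Emb_rel[OF e] h(1)
        word_less_map[of f "carr A" "related B r" "related A r" h u v]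
        word_adj_map[of f "carr A" "related B r" "related A r" u v h]
      by (cases "r = adj") (simp_all add: word_rel_def)
    then show "rel (ext B) r [lift h A f x, lift h A f y] \<longleftrightarrow> rel (ext A) r [x, y]"
      if "x \<in> carr (ext A)" "y \<in> carr (ext A)" for r x y
      using that map_in_words[OF f] by (auto simp: carr_ext lift_to_nat rel_ext)
  qed
  moreover have "carr (ext B) \<subseteq> lift h A f ` carr (ext A)"
  proof -
    let ?g = "restrict (inv_into (carr A) f) (carr B)"
    have "to_nat v \<in> lift h A f ` carr (ext A)" if v: "v \<in> words B" for v
    proof (rule image_eqI)
      \<comment> \<open>This preimage is a word over \<open>A\<close>: which integers occur in a
        word does not affect membership in \<open>words A\<close>.\<close>
      let ?u = "map (map_sum ?g (inv h)) v"
      have u: "?u \<in> words A"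
        using map_in_words[OF Iso_inv[OF f] v] .
      have "map_sum f h (map_sum ?g (inv h) s) = s" if "s \<in> set v" for s
        using that words_letters[OF v] Iso_image[OF f] h(2)
        by - (cases s; auto simp: f_inv_into_f surj_f_inv_f)
      then have "map (map_sum f h) ?u = v"
        unfolding map_map by (intro map_idI) (metis comp_apply)
      then show "to_nat v = lift h A f (to_nat ?u)"
        using lift_to_nat[OF u] by metis
      show "to_nat ?u \<in> carr (ext A)"
        using u by (simp add: carr_ext)
    qed
    then show ?thesis
      by (auto simp: carr_ext)
  qed
  ultimately show ?thesis
    unfolding Iso_def by (auto dest: Emb_mem)
qed

lemma lift_incl: "x \<in> carr A \<Longrightarrow> f x \<in> carr B \<Longrightarrow> lift h A f (incl A x) = incl B (f x)"
  by (simp add: incl_def lift_to_nat old_in_words)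

text \<open>A word outside the image of \<open>incl\<close> has an integer letter, and
  \<open>h\<close> changes that letter in place.\<close>

lemma lift_no_fixed_point:
  assumes y: "y \<in> carr (ext A) - incl A ` carr A" and h: "\<And>i. h i \<noteq> i"
  shows "lift h A f y \<noteq> y"
proof -
  obtain w where w: "w \<in> words A" "y = to_nat w"
    using y by (auto simp: carr_ext)
  then have "w \<noteq> [Inl a]" if "a \<in> carr A" for a
    using y that by (auto simp: incl_def)
  then obtain i where "Inr i \<in> set w"
    using w(1) unfolding words_def by blast
  then have "map (map_sum f h) w \<noteq> w"
    using h by (metis Inr_inject map_idI map_eq_conv map_ident map_sum.simps(2))
  then show ?thesis
    using w by (simp add: lift_to_nat)
qed

text \<open>Checked on single letters: the hypothesis handles letters from \<open>A\<close>, and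
  \<open>id\<close> commutes with \<open>h\<close> on integers.\<close>

lemma lift_commute:
  assumes f: "f \<in> Iso A B" and \<phi>: "\<phi> \<in> Aut A"
    and comm: "\<forall>x \<in> carr A. f (\<phi> x) = \<psi> (f x)" and y: "y \<in> carr (ext A)"
  shows "lift id A f (lift h A \<phi> y) = lift h B \<psi> (lift id A f y)"
proof -
  obtain w where w: "w \<in> words A" "y = to_nat w"
    using y by (auto simp: carr_ext)
  have "map_sum f id (map_sum \<phi> h s) = map_sum \<psi> h (map_sum f id s)" if "s \<in> set w" for s
    using that words_letters[OF w(1)] comm by - (cases s; auto)
  then show ?thesis
    using w map_in_words[OF f w(1)] map_in_words[OF \<phi>[unfolded Aut_def] w(1)]
    by (simp add: lift_to_nat)
qed


section \<open>Measurability\<close>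

lemma pred_words:
  fixes E :: "'a \<Rightarrow> 'r rstruct"
  assumes E: "E \<in> borel_measurable M"
  shows "Measurable.pred M (\<lambda>x. w \<in> words (E x))"
proof -
  note [measurable] = pred_carr[OF E] pred_rel[OF E]
  have [measurable]: "Measurable.pred M (\<lambda>x. K_free n (nbrs w) (related (E x) adj))" for n
    by (rule pred_K_free) measurable
  \<comment> \<open>Bounded quantifiers over sets that vary with \<open>x\<close> are rewritten as
    quantifiers over countable types.\<close>
  have "w \<in> words (E x) \<longleftrightarrow> (\<exists>a. a \<in> carr (E x) \<and> w = [Inl a]) \<or>
      (\<forall>a. Inl a \<in> set w \<longrightarrow> a \<in> carr (E x)) \<and> (\<exists>i. Inr i \<in> set w) \<and>
      (\<forall>n. n \<in> N \<longrightarrow> K_free (n - 1) (nbrs w) (related (E x) adj))" for x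
    unfolding words_def by auto
  then show ?thesis
    by simp
qed

lemma pred_word_rel:
  fixes E :: "'a \<Rightarrow> 'r rstruct"
  assumes "E \<in> borel_measurable M"
  shows "Measurable.pred M (\<lambda>x. word_rel r (related (E x) r) u v)"
proof -
  note [measurable] = pred_rel[OF assms]
  have "Measurable.pred M (\<lambda>x. word_adj (related (E x) r) u v)"
    "Measurable.pred M (\<lambda>x. (u, v) \<in> word_less (related (E x) r))"
    by (intro pred_word_adj pred_word_less; measurable)+
  then show ?thesis
    unfolding word_rel_def by simp
qed

text \<open>There are only countably many words, so the quantifiers over \<open>words A\<close> are
  countable unions of Borel conditions.\<close>

lemma measurable_ext: "ext \<in> borel_measurable borel"
proof (rule borel_measurable_rstructI)
  note [measurable] = pred_words[OF measurable_ident_sets[OF refl]] pred_word_rel[OF measurable_ident_sets[OF refl]]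
  show "Measurable.pred borel (\<lambda>A. y \<in> carr (ext A))" for y
    unfolding carr_ext image_iff Bex_def by measurable
  show "Measurable.pred borel (\<lambda>A. rel (ext A) r ys)" for r ys
    unfolding rel_ext_iff Bex_def by measurable
qed

lemma measurable_incl: "incl \<in> borel_measurable borel"
proof (rule measurable_coordinatewise_then_product)
  note [measurable] = pred_carr[OF measurable_ident_sets[OF refl]]
  show "(\<lambda>A. incl A x) \<in> borel_measurable borel" for x
    unfolding incl_def restrict_def by measurable
qed

text \<open>For fixed \<open>y\<close> the word \<open>from_nat y\<close> is fixed too, so the value
  depends on whether \<open>y\<close> lies in the extension and on finitely many values of
  \<open>f\<close>.\<close>

lemma measurable_lift: "(\<lambda>(A, f). lift h A f) \<in> borel_measurable borel"
proof (rule measurable_coordinatewise_then_product)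
  fix y
  have "fst \<in> borel_measurable (borel :: ('r rstruct \<times> (nat \<Rightarrow> nat)) measure)"
    and snd: "snd \<in> borel_measurable (borel :: ('r rstruct \<times> (nat \<Rightarrow> nat)) measure)"
    by (intro borel_measurable_continuous_onI continuous_intros)+
  from pred_carr[OF measurable_compose[OF this(1) measurable_ext]]
  have [measurable]: "Measurable.pred borel (\<lambda>x :: 'r rstruct \<times> (nat \<Rightarrow> nat). y \<in> carr (ext (fst x)))" .
  have [measurable]: "(\<lambda>x :: 'r rstruct \<times> (nat \<Rightarrow> nat). map (map_sum (snd x) h) (from_nat y))
      \<in> borel \<rightarrow>\<^sub>M count_space UNIV"
    using measurable_product_then_coordinatewise[OF snd]
    by (intro measurable_map_map_sum) (simp add: borel_measurable_iff_count_space)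
  show "(\<lambda>x. (case x of (A, f) \<Rightarrow> lift h A f) y) \<in> borel_measurable borel"
    unfolding split_beta lift_def restrict_def borel_measurable_iff_count_space by measurable
qed

lemma cls_borel: "cls \<in> sets borel"
proof -
  note [measurable] = pred_carr[OF measurable_ident_sets[OF refl]] pred_rel[OF measurable_ident_sets[OF refl]]
  have [measurable]: "Measurable.pred borel (\<lambda>A :: 'r rstruct. K_free n (carr A) (related A adj))" for n
    by (rule pred_K_free) measurable
  have "Measurable.pred borel (\<lambda>A :: 'r rstruct. is_struct (\<lambda>_. 2) A)"
    unfolding is_struct_def subset_iff by measurable
  moreover have "Measurable.pred borel (\<lambda>A :: 'r rstruct. graph_on (carr A) (related A adj))"
    unfolding graph_on_def symp_on_def irreflp_on_def Ball_def by measurable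
  moreover have "Measurable.pred borel
      (\<lambda>A :: 'r rstruct. strict_linear_order_on (carr A) {(x, y). rel A r [x, y]})" for r
    unfolding strict_linear_order_on_def trans_def irrefl_def total_on_def Ball_def mem_Collect_eq split_conv
    by measurable
  ultimately have [measurable]: "Measurable.pred borel (\<lambda>A. A \<in> cls)"
    unfolding cls_def mem_Collect_eq Ball_def by measurable
  then show ?thesis
    unfolding pred_def by simp
qed

lemma ABAP_cls: "ABAP (\<lambda>_. 2) cls"
  unfolding ABAP_def
proof (intro conjI)
  \<comment> \<open>The inverse of an isomorphism from \<open>A\<close> to \<open>B\<close> embeds
    \<open>B\<close> into \<open>A\<close>.\<close>
  have "B \<in> cls" if "A \<in> cls" "is_struct (\<lambda>_. 2) B" "Iso A B \<noteq> {}" for A B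
    using that cls_hereditary Iso_inv Iso_imp_Emb by blast
  then show "structure_class (\<lambda>_. 2) cls"
    using cls_struct cls_borel unfolding structure_class_def by blast
next
  have shift: "strict_mono ((+) (1 :: int))" "surj ((+) (1 :: int))"
    by (auto simp: strict_mono_def)
  have id: "strict_mono (id :: int \<Rightarrow> int)" "surj (id :: int \<Rightarrow> int)"
    by (auto simp: strict_mono_def)
  show "\<exists>E \<eta> T H. E \<in> restrict_space borel cls \<rightarrow>\<^sub>M borel \<and>
      \<eta> \<in> restrict_space borel cls \<rightarrow>\<^sub>M borel \<and>
      (\<forall>A \<in> cls. E A \<in> cls \<and> \<eta> A \<in> Emb A (E A) \<and>
        (\<forall>\<tau>. admissible_type (\<lambda>_. 2) cls A \<tau> \<longrightarrow> (\<exists>c. realizes (E A) (\<eta> A) c \<tau>))) \<and>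
      (\<lambda>(A, \<phi>). T A \<phi>) \<in> restrict_space borel {(A, \<phi>). A \<in> cls \<and> \<phi> \<in> Aut A} \<rightarrow>\<^sub>M borel \<and>
      (\<forall>A \<in> cls. \<forall>\<phi> \<in> Aut A. T A \<phi> \<in> Aut (E A) \<and>
        (\<forall>x \<in> carr A. T A \<phi> (\<eta> A x) = \<eta> A (\<phi> x)) \<and>
        (\<forall>y \<in> carr (E A) - \<eta> A ` carr A. T A \<phi> y \<noteq> y)) \<and>
      (\<forall>A\<^sub>0 \<in> cls. \<forall>A\<^sub>1 \<in> cls. \<forall>\<alpha> \<in> Iso A\<^sub>0 A\<^sub>1.
        H A\<^sub>0 A\<^sub>1 \<alpha> \<in> Iso (E A\<^sub>0) (E A\<^sub>1) \<and>
        (\<forall>x \<in> carr A\<^sub>0. H A\<^sub>0 A\<^sub>1 \<alpha> (\<eta> A\<^sub>0 x) = \<eta> A\<^sub>1 (\<alpha> x)) \<and>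
        (\<forall>\<phi>\<^sub>0 \<in> Aut A\<^sub>0. \<forall>\<phi>\<^sub>1 \<in> Aut A\<^sub>1.
          (\<forall>x \<in> carr A\<^sub>0. \<alpha> (\<phi>\<^sub>0 x) = \<phi>\<^sub>1 (\<alpha> x)) \<longrightarrow>
          (\<forall>y \<in> carr (E A\<^sub>0). H A\<^sub>0 A\<^sub>1 \<alpha> (T A\<^sub>0 \<phi>\<^sub>0 y) = T A\<^sub>1 \<phi>\<^sub>1 (H A\<^sub>0 A\<^sub>1 \<alpha> y))))"
  \<comment> \<open>Automorphisms shift the integers by 1, isomorphisms fix them; both act
    letterwise on the elements of the structure.\<close>
  proof (rule exI[of _ ext], rule exI[of _ incl], rule exI[of _ "lift ((+) 1)"],
      rule exI[of _ "\<lambda>A B. lift id A"], intro conjI ballI allI impI)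
    show "ext \<in> restrict_space borel cls \<rightarrow>\<^sub>M borel" "incl \<in> restrict_space borel cls \<rightarrow>\<^sub>M borel"
      by (intro measurable_restrict_space1 measurable_ext measurable_incl)+
    show "(\<lambda>(A, \<phi>). lift ((+) 1) A \<phi>)
        \<in> restrict_space borel {(A, \<phi>). A \<in> cls \<and> \<phi> \<in> Aut A} \<rightarrow>\<^sub>M borel"
      by (intro measurable_restrict_space1 measurable_lift)
    show "lift ((+) 1) A \<phi> \<in> Aut (ext A)" if "\<phi> \<in> Aut A" for A \<phi>
      using that lift_Iso[OF _ shift] unfolding Aut_def by blast
    show "lift ((+) 1) A \<phi> (incl A x) = incl A (\<phi> x)" if "\<phi> \<in> Aut A" "x \<in> carr A" for A \<phi> x
      using that Emb_mem[OF Iso_imp_Emb] unfolding Aut_def by (intro lift_incl)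
    show "lift id A \<alpha> (incl A x) = incl B (\<alpha> x)" if "\<alpha> \<in> Iso A B" "x \<in> carr A" for A B \<alpha> x
      using that Emb_mem[OF Iso_imp_Emb] by (intro lift_incl)
    show "ext A \<in> cls" "incl A \<in> Emb A (ext A)" if "A \<in> cls" for A
      using that by (rule ext_in_cls, rule incl_Emb)
    show "\<exists>c. realizes (ext A) (incl A) c \<tau>"
      if "A \<in> cls" "admissible_type (\<lambda>_. 2) cls A \<tau>" for A \<tau>
      using that by (rule ext_realizes)
    show "lift ((+) 1) A \<phi> y \<noteq> y" if "y \<in> carr (ext A) - incl A ` carr A" for A \<phi> y
      using that by (rule lift_no_fixed_point) simp
    show "lift id A \<alpha> \<in> Iso (ext A) (ext B)" if "\<alpha> \<in> Iso A B" for A B \<alpha>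
      using that id by (rule lift_Iso)
    show "lift id A \<alpha> (lift ((+) 1) A \<phi> y) = lift ((+) 1) B \<psi> (lift id A \<alpha> y)"
      if "\<alpha> \<in> Iso A B" "\<phi> \<in> Aut A" "\<forall>x \<in> carr A. \<alpha> (\<phi> x) = \<psi> (\<alpha> x)" "y \<in> carr (ext A)"
      for A B \<alpha> \<phi> \<psi> y
      using that by (rule lift_commute)
  qed
qed

end

section \<open>The four classes as instances of the locale\<close>

theorem theorem5p1:
  fixes n :: nat
  assumes "n > 0"
  shows "ABAP graph_ar graphs \<and>
         ABAP graph_ar (K_free_graphs n) \<and>
         ABAP ograph_ar ordered_graphs \<and>
         ABAP ograph_ar (K_free_ordered_graphs n)"
proof -
  have ar: "graph_ar = (\<lambda>_. 2)" "ograph_ar = (\<lambda>_. 2)"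
    by (auto simp: graph_ar_def ograph_ar_def)
  have g: "(r = Adj) = True" for r
    by (cases r) simp
  have og: "r \<noteq> OAdj \<longleftrightarrow> r = OLess" for r
    by (cases r) simp_all
  \<comment> \<open>The set \<open>N\<close> is empty when no clique is forbidden and
    \<open>{n}\<close> otherwise. For graphs there is no symbol besides \<open>Adj\<close>, so the
    conditions on order symbols are vacuous.\<close>
  interpret G: forbidden_cliques Adj "{}"
    by standard (auto simp: g)
  interpret GK: forbidden_cliques Adj "{n}"
    using assms by unfold_locales (auto simp: g)
  interpret O: forbidden_cliques OAdj "{}"
    by standard (auto simp: og)
  interpret OK: forbidden_cliques OAdj "{n}"
    using assms by unfold_locales (auto simp: og)
  have "G.cls = graphs"
    by (auto simp: G.cls_def graphs_def ar g)
  moreover have "GK.cls = K_free_graphs n"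
    by (auto simp: GK.cls_def K_free_graphs_def graphs_def ar g)
  moreover have "O.cls = ordered_graphs"
    by (auto simp: O.cls_def ordered_graphs_def ar og)
  moreover have "OK.cls = K_free_ordered_graphs n"
    by (auto simp: OK.cls_def K_free_ordered_graphs_def ordered_graphs_def ar og)
  ultimately show ?thesis
    using G.ABAP_cls GK.ABAP_cls O.ABAP_cls OK.ABAP_cls unfolding ar by simp
qed

end
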